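(* Suppose that a part $\beta W$ of the shared bandwidth $W$ is provisioned as open access, and the remainder is partitioned as $W_i$, $i=1,2$, and allocated as licensed (intermittent) bandwidth to the respective SPs, where $\beta\in[0,1]$ and $W_1+W_2=(1-\beta)W$. Then there is a unique equilibrium with $w_1^*=0$, $x_1^*>0$ and $x_2^*>w_2^*>0$ if and only if $$B_1+W_1+2(1-\alpha)\frac{W_1}{B_1}\ \ge\ 2(\beta W+W_2)+2B_2+2+4(1-\alpha)\frac{\beta W+W_2}{B_2}.$$ For $\beta=1$, all the shared bandwidth is open access and this condition simplifies to $B_1\ge 2W+4(1-\alpha)\frac{W}{B_2}+2B_2+2$.
   Context: Two service providers (SPs) $i=1,2$ play a one-shot Cournot game. SP $i$ has $B_i$ units of always-available proprietary bandwidth and $W_i\ge 0$ units of licensed shared bandwidth; a band of $\beta W$ units is open access to both SPs (if $\beta=0$ there is no open access band). All shared bandwidth (licensed and open access) is simultaneously available with probability $\alpha\in[0,1]$; when it is unavailable, an SP's shared-band traffic moves to its proprietary band. SP $i$ chooses $x_i\ge 0$ (traffic on its own bands, i.e. proprietary plus licensed shared) and $w_i\ge 0$ (traffic on the open access band). The delivered price is $p_d=1-\sum_{j}(x_j+w_j)$, and the prices obtained by SP $i$ are $$p_i=p_d-(1-\alpha)\frac{x_i+w_i}{B_i}-\alpha\frac{x_i}{B_i+W_i},\qquad p_i^w=p_d-\alpha\frac{\sum_j w_j}{\beta W}-(1-\alpha)\frac{x_i+w_i}{B_i}.$$ SP $i$ maximizes its revenue $R_i=p_ix_i+p_i^ww_i$.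 An equilibrium is a pure Nash equilibrium $(x_1^*,w_1^*,x_2^*,w_2^* )$ of this game.
   Formalization: Taken with α>0, β>0, W>0 (at α=0 uniqueness fails; with βW=0, w₂*>0 is impossible). The equivalence is proved with x₂*>0, w₂*>0 in place of x₂*>w₂*>0; the literal version holds iff, in addition, βW < B₂+W₂. *)

theory Defs
  imports Complex_Main
begin

datatype sp = SP1 | SP2

text \<open>
  Parameters: \<open>\<alpha>\<close> is the availability of the shared bandwidth, \<open>B i\<close> the proprietary and
  \<open>L i\<close> the licensed shared bandwidth of provider \<open>i\<close>,
  and \<open>C\<close> is the open access bandwidth (\<open>\<beta> * W\<close>). The functions \<open>x\<close> and \<open>w\<close> give the traffic on the
  own bands and on the open access band. The definitions model the game only for
  \<open>B i > 0\<close>, \<open>L i \<ge> 0\<close> and \<open>C > 0\<close>; for \<open>C = 0\<close> there is no open access band, whereas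
  division by zero would make that band free of congestion.
\<close>

definition delivered_price :: "(sp \<Rightarrow> real) \<Rightarrow> (sp \<Rightarrow> real) \<Rightarrow> real" where
  "delivered_price x w = 1 - (\<Sum>j\<in>UNIV. x j + w j)"

definition own_price ::
  "real \<Rightarrow> (sp \<Rightarrow> real) \<Rightarrow> (sp \<Rightarrow> real) \<Rightarrow> (sp \<Rightarrow> real) \<Rightarrow> (sp \<Rightarrow> real) \<Rightarrow> sp \<Rightarrow> real" where
  "own_price \<alpha> B L x w i =
     delivered_price x w - (1 - \<alpha>) * ((x i + w i) / B i) - \<alpha> * (x i / (B i + L i))"

definition open_price ::
  "real \<Rightarrow> (sp \<Rightarrow> real) \<Rightarrow> real \<Rightarrow> (sp \<Rightarrow> real) \<Rightarrow> (sp \<Rightarrow> real) \<Rightarrow> sp \<Rightarrow> real" where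
  "open_price \<alpha> B C x w i =
     delivered_price x w - \<alpha> * ((\<Sum>j\<in>UNIV. w j) / C) - (1 - \<alpha>) * ((x i + w i) / B i)"

definition revenue ::
  "real \<Rightarrow> (sp \<Rightarrow> real) \<Rightarrow> (sp \<Rightarrow> real) \<Rightarrow> real \<Rightarrow> (sp \<Rightarrow> real) \<Rightarrow> (sp \<Rightarrow> real) \<Rightarrow> sp \<Rightarrow> real" where
  "revenue \<alpha> B L C x w i =
     own_price \<alpha> B L x w i * x i + open_price \<alpha> B C x w i * w i"

definition equilibrium ::
  "real \<Rightarrow> (sp \<Rightarrow> real) \<Rightarrow> (sp \<Rightarrow> real) \<Rightarrow> real \<Rightarrow> (sp \<Rightarrow> real) \<times> (sp \<Rightarrow> real) \<Rightarrow> bool" where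
  "equilibrium \<alpha> B L C = (\<lambda>(x, w).
     (\<forall>i. 0 \<le> x i \<and> 0 \<le> w i) \<and>
     (\<forall>i a b. 0 \<le> a \<longrightarrow> 0 \<le> b \<longrightarrow>
        revenue \<alpha> B L C (x(i := a)) (w(i := b)) i \<le> revenue \<alpha> B L C x w i))"

definition bandwidth_condition ::
  "real \<Rightarrow> (sp \<Rightarrow> real) \<Rightarrow> (sp \<Rightarrow> real) \<Rightarrow> real \<Rightarrow> bool" where
  "bandwidth_condition \<alpha> B L C \<longleftrightarrow>
     B SP1 + L SP1 + 2 * (1 - \<alpha>) * (L SP1 / B SP1)
       \<ge> 2 * (C + L SP2) + 2 * B SP2 + 2 + 4 * (1 - \<alpha>) * ((C + L SP2) / B SP2)"

end

theory Submission
  imports Defs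
begin

text \<open>
  Each revenue is a strictly concave quadratic in the provider's own two decisions, so an equilibrium
  is a solution of the variational inequality for the marginal revenues. The marginal revenues form
  a strictly monotone affine map: its quadratic form is a positive combination of
  \<open>T\<^sub>1\<^sup>2 + T\<^sub>2\<^sup>2 + (T\<^sub>1 + T\<^sub>2)\<^sup>2\<close> with \<open>T\<^sub>i = x\<^sub>i + w\<^sub>i\<close>,
  \<open>w\<^sub>1\<^sup>2 + w\<^sub>2\<^sup>2 + (w\<^sub>1 + w\<^sub>2)\<^sup>2\<close> and squares. Hence there is at most one equilibrium.
  On the sign pattern \<open>w\<^sub>1 = 0\<close> the first order conditions say that provider 2 spreads its traffic \<open>T\<^sub>2\<close>
  proportionally to \<open>B\<^sub>2 + W\<^sub>2\<close> and \<open>\<beta>W\<close> and that \<open>x\<^sub>1, T\<^sub>2\<close> solve a linear \<open>2 \<times> 2\<close> system; the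
  remaining inequality, that provider 1 gains nothing from entering the open access band,
  is the bandwidth condition.
\<close>

lemma UNIV_sp: "UNIV = {SP1, SP2}"
  using sp.exhaust by auto

lemma sum_sp: "(\<Sum>j\<in>UNIV. f j) = f SP1 + (f SP2 :: real)"
  by (simp add: UNIV_sp)

lemma all_sp: "(\<forall>i. P i) \<longleftrightarrow> P SP1 \<and> P SP2"
  by (metis sp.exhaust)

text \<open>Dividing by \<open>t\<close> and letting \<open>t\<close> tend to 0 removes the
  quadratic term. This turns optimality along a segment of deviations into a first order
  condition.\<close>

lemma linear_le_quadratic_imp_nonpos:
  fixes g q :: real
  assumes "\<And>t. 0 < t \<Longrightarrow> t \<le> 1 \<Longrightarrow> t * g \<le> t\<^sup>2 * q"
  shows "g \<le> 0"
proof (rule ccontr)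
  assume "\<not> g \<le> 0"
  then have g: "0 < g" by simp
  \<comment> \<open>Since \<open>q < g + \<bar>q\<bar> + 1\<close>, this step size gives
    \<open>t * q < g\<close>.\<close>
  define t where "t = g / (g + \<bar>q\<bar> + 1)"
  have t: "0 < t" "t \<le> 1"
    using g by (auto simp: t_def divide_simps)
  have "t * g \<le> t * (t * q)"
    using assms[OF t] by (simp add: power2_eq_square mult.assoc)
  then have "g \<le> t * q"
    using t by simp
  also have "\<dots> = g * (q / (g + \<bar>q\<bar> + 1))"
    by (simp add: t_def)
  also have "\<dots> < g * 1"
    using g by (intro mult_strict_left_mono) (auto simp: divide_simps)
  finally show False by simp
qed

section \<open>Marginal revenues and first order conditions\<close>

definition own_marginal ::
  "real \<Rightarrow> (sp \<Rightarrow> real) \<Rightarrow> (sp \<Rightarrow> real) \<Rightarrow> (sp \<Rightarrow> real) \<Rightarrow> (sp \<Rightarrow> real) \<Rightarrow> sp \<Rightarrow> real" where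
  "own_marginal \<alpha> B L x w i =
     delivered_price x w - (x i + w i) - 2 * (1 - \<alpha>) * ((x i + w i) / B i)
       - 2 * \<alpha> * (x i / (B i + L i))"

text \<open>Both marginals are partial derivatives of \<open>revenue\<close> in the provider's own
  decision. On the open band own traffic counts twice and the rival's once; this asymmetry is the
  source of the factor 2 between the sides of the bandwidth condition.\<close>

definition open_marginal ::
  "real \<Rightarrow> (sp \<Rightarrow> real) \<Rightarrow> real \<Rightarrow> (sp \<Rightarrow> real) \<Rightarrow> (sp \<Rightarrow> real) \<Rightarrow> sp \<Rightarrow> real" where
  "open_marginal \<alpha> B C x w i =
     delivered_price x w - (x i + w i) - 2 * (1 - \<alpha>) * ((x i + w i) / B i)
       - \<alpha> * (((\<Sum>j\<in>UNIV. w j) + w i) / C)"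

text \<open>The revenue is quadratic in \<open>x i\<close> and \<open>w i\<close>, so its Taylor
  expansion ends at second order: gradient part minus curvature.\<close>

lemma revenue_deviation:
  "revenue \<alpha> B L C (x(i := a)) (w(i := b)) i - revenue \<alpha> B L C x w i =
     own_marginal \<alpha> B L x w i * (a - x i) + open_marginal \<alpha> B C x w i * (b - w i)
     - ((1 + (1 - \<alpha>) / B i) * ((a - x i) + (b - w i))\<^sup>2
        + \<alpha> / (B i + L i) * (a - x i)\<^sup>2 + \<alpha> / C * (b - w i)\<^sup>2)"
  by (cases i)
    (simp_all add: revenue_def own_price_def open_price_def own_marginal_def open_marginal_def
      delivered_price_def sum_sp divide_inverse power2_eq_square algebra_simps)

text \<open>Strict positivity of \<open>\<alpha>\<close> makes the bands distinguishable: at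
  \<open>\<alpha> = 0\<close> revenue depends only on the providers' totals, and uniqueness is
  lost.\<close>

locale bandwidth_game =
  fixes \<alpha> :: real and B L :: "sp \<Rightarrow> real" and C :: real
  assumes \<alpha>_pos: "0 < \<alpha>" and \<alpha>_le_1: "\<alpha> \<le> 1"
    and B_pos: "0 < B i" and L_nonneg: "0 \<le> L i" and C_pos: "0 < C"
begin

abbreviation "own \<equiv> own_marginal \<alpha> B L"
abbreviation "opn \<equiv> open_marginal \<alpha> B C"

lemma BL_pos: "0 < B i + L i"
  using B_pos[of i] L_nonneg[of i] by simp

lemma curvature_nonneg:
  "0 \<le> (1 + (1 - \<alpha>) / B i) * (u + v)\<^sup>2 + \<alpha> / (B i + L i) * u\<^sup>2 + \<alpha> / C * v\<^sup>2"
  using \<alpha>_pos \<alpha>_le_1 B_pos[of i] BL_pos[of i] C_pos by (simp add: add_nonneg_nonneg)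

text \<open>By \<open>revenue_deviation\<close>, small multiples of a deviation expose its linear
  part; conversely, nonnegative curvature only lowers the gain.\<close>

lemma equilibrium_iff_variational:
  "equilibrium \<alpha> B L C (x, w) \<longleftrightarrow>
     (\<forall>i. 0 \<le> x i \<and> 0 \<le> w i) \<and>
     (\<forall>i a b. 0 \<le> a \<longrightarrow> 0 \<le> b \<longrightarrow> own x w i * (a - x i) + opn x w i * (b - w i) \<le> 0)"
  (is "_ \<longleftrightarrow> ?nonneg \<and> ?vi")
proof
  assume eq: "equilibrium \<alpha> B L C (x, w)"
  then have nonneg: ?nonneg
    and max: "\<And>i a b. 0 \<le> a \<Longrightarrow> 0 \<le> b \<Longrightarrow>
      revenue \<alpha> B L C (x(i := a)) (w(i := b)) i - revenue \<alpha> B L C x w i \<le> 0"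
    by (auto simp: equilibrium_def)
  have ?vi
  proof (intro allI impI)
    fix i and a b :: real
    assume ab: "0 \<le> a" "0 \<le> b"
    let ?u = "a - x i" and ?v = "b - w i"
    show "own x w i * ?u + opn x w i * ?v \<le> 0"
    proof (rule linear_le_quadratic_imp_nonpos)
      fix t :: real
      assume t: "0 < t" "t \<le> 1"
      have "x i + t * ?u = (1 - t) * x i + t * a" "w i + t * ?v = (1 - t) * w i + t * b"
        by (simp_all add: algebra_simps)
      then have "0 \<le> x i + t * ?u" "0 \<le> w i + t * ?v"
        using t ab nonneg by simp_all
      from max[OF this, of i]
      show "t * (own x w i * ?u + opn x w i * ?v)
        \<le> t\<^sup>2 * ((1 + (1 - \<alpha>) / B i) * (?u + ?v)\<^sup>2 + \<alpha> / (B i + L i) * ?u\<^sup>2 + \<alpha> / C * ?v\<^sup>2)"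
        unfolding revenue_deviation
        by (simp add: power_mult_distrib distrib_left[symmetric] mult.left_commute)
           (simp add: power_mult_distrib distrib_left mult.left_commute)
    qed
  qed
  with nonneg show "?nonneg \<and> ?vi" ..
next
  assume "?nonneg \<and> ?vi"
  then have nonneg: ?nonneg and vi: ?vi by auto
  have "revenue \<alpha> B L C (x(i := a)) (w(i := b)) i - revenue \<alpha> B L C x w i \<le> 0"
    if "0 \<le> a" "0 \<le> b" for i a b
  proof -
    have "own x w i * (a - x i) + opn x w i * (b - w i) \<le> 0"
      using vi that by blast
    then show ?thesis
      unfolding revenue_deviation using curvature_nonneg[of i "a - x i" "b - w i"] by linarith
  qed
  with nonneg show "equilibrium \<alpha> B L C (x, w)"
    by (simp add: equilibrium_def)
qed

lemma equilibrium_own_stationary: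
  assumes "equilibrium \<alpha> B L C (x, w)" and "0 < x i"
  shows "own x w i = 0"
proof -
  have *: "own x w i * (a - x i) \<le> 0" if "0 \<le> a" for a
    using assms(1) that unfolding equilibrium_iff_variational
    by (metis add.right_neutral diff_self mult_zero_right)
  show ?thesis
    \<comment> \<open>Moving to 0 and to \<open>2 * x i\<close> are opposite steps, which bounds the
      marginal from both sides.\<close>
    using *[of 0] *[of "2 * x i"] assms(2) by (simp add: mult_le_0_iff zero_le_mult_iff)
qed

lemma equilibrium_open_stationary:
  assumes "equilibrium \<alpha> B L C (x, w)" and "0 < w i"
  shows "opn x w i = 0"
proof -
  have *: "opn x w i * (b - w i) \<le> 0" if "0 \<le> b" for b
    using assms(1) that unfolding equilibrium_iff_variational
    by (metis add_0 diff_self mult_zero_right)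
  show ?thesis
    using *[of 0] *[of "2 * w i"] assms(2) by (simp add: mult_le_0_iff zero_le_mult_iff)
qed

lemma equilibrium_open_nonpos:
  assumes "equilibrium \<alpha> B L C (x, w)"
  shows "opn x w i \<le> 0"
proof -
  have "own x w i * (x i - x i) + opn x w i * (w i + 1 - w i) \<le> 0"
    using assms unfolding equilibrium_iff_variational
    by (metis add_nonneg_nonneg zero_le_one)
  then show ?thesis by simp
qed

section \<open>Strict monotonicity and uniqueness\<close>

lemma marginals_strictly_monotone:
  fixes x w x' w' :: "sp \<Rightarrow> real"
  assumes "0 \<le> (\<Sum>i\<in>UNIV. (own x w i - own x' w' i) * (x i - x' i)
                        + (opn x w i - opn x' w' i) * (w i - w' i))"
  shows "x = x'" "w = w'"
proof -
  define u v where "u i = x i - x' i" and "v i = w i - w' i" for i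
  define K where "K i = 2 * (1 - \<alpha>) / B i * (u i + v i)\<^sup>2" for i
  define M where "M i = 2 * \<alpha> / (B i + L i) * (u i)\<^sup>2" for i
  define N where "N = \<alpha> / C * ((v SP1)\<^sup>2 + (v SP2)\<^sup>2 + (v SP1 + v SP2)\<^sup>2)"
  define T where "T = (u SP1 + v SP1)\<^sup>2 + (u SP2 + v SP2)\<^sup>2
    + (u SP1 + v SP1 + u SP2 + v SP2)\<^sup>2"
  have "(\<Sum>i\<in>UNIV. (own x w i - own x' w' i) * (x i - x' i)
                 + (opn x w i - opn x' w' i) * (w i - w' i))
      = - (T + K SP1 + K SP2 + M SP1 + M SP2 + N)"
    by (simp add: T_def K_def M_def N_def u_def v_def own_marginal_def open_marginal_def
        delivered_price_def sum_sp divide_inverse power2_eq_square algebra_simps)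
  then have le: "T + K SP1 + K SP2 + M SP1 + M SP2 + N \<le> 0"
    using assms by linarith
  have nonneg: "0 \<le> T" "0 \<le> K i" "0 \<le> M i" "0 \<le> N" for i
    using \<alpha>_pos \<alpha>_le_1 B_pos[of i] BL_pos[of i] C_pos
    by (simp_all add: T_def K_def M_def N_def)
  \<comment> \<open>\<open>T\<close> and \<open>K\<close> see only differences of totals;
    \<open>M\<close> and \<open>N\<close>, which carry the factor \<open>\<alpha>\<close>, force
    \<open>u\<close> and \<open>v\<close> to vanish separately.\<close>
  have zero: "N = 0" "M SP1 = 0" "M SP2 = 0"
    using le nonneg(1,4) nonneg(2,3)[of SP1] nonneg(2,3)[of SP2] by linarith+
  have "u i = 0" for i
    using zero(2,3) \<alpha>_pos BL_pos[of i] by (cases i) (auto simp: M_def)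
  then show "x = x'"
    by (auto simp: u_def)
  have "(v SP1)\<^sup>2 + (v SP2)\<^sup>2 + (v SP1 + v SP2)\<^sup>2 = 0"
    using zero(1) \<alpha>_pos C_pos by (simp add: N_def)
  then have "v i = 0" for i
    by (cases i) (simp_all add: add_nonneg_eq_0_iff)
  then show "w = w'"
    by (auto simp: v_def)
qed

lemma equilibrium_unique:
  assumes "equilibrium \<alpha> B L C e" "equilibrium \<alpha> B L C e'"
  shows "e = e'"
proof -
  obtain x w x' w' where e: "e = (x, w)" "e' = (x', w')"
    by fastforce
  \<comment> \<open>Each equilibrium serves as the deviation in the other's variational
    inequality.\<close>
  have "own x w i * (x' i - x i) + opn x w i * (w' i - w i) \<le> 0"
    and "own x' w' i * (x i - x' i) + opn x' w' i * (w i - w' i) \<le> 0" for i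
    using assms unfolding e equilibrium_iff_variational by auto
  then have "0 \<le> (own x w i - own x' w' i) * (x i - x' i)
                  + (opn x w i - opn x' w' i) * (w i - w' i)" for i
    by (smt (verit) left_diff_distrib right_diff_distrib)
  then have "0 \<le> (\<Sum>i\<in>UNIV. (own x w i - own x' w' i) * (x i - x' i)
                        + (opn x w i - opn x' w' i) * (w i - w' i))"
    by (intro sum_nonneg)
  then show ?thesis
    using marginals_strictly_monotone e by simp
qed

section \<open>Equilibria with provider 1 off the open access band\<close>

text \<open>
  The coefficients of the reduced system \<open>a\<^sub>1 x\<^sub>1 + T\<^sub>2 = 1\<close>, \<open>x\<^sub>1 + a\<^sub>2 T\<^sub>2 = 1\<close>.
\<close>

definition "a1 = 2 * (1 + (1 - \<alpha>) / B SP1) + 2 * \<alpha> / (B SP1 + L SP1)"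
definition "a2 = 2 * (1 + (1 - \<alpha>) / B SP2) + 2 * \<alpha> / (B SP2 + L SP2 + C)"

lemma a1_gt_2: "2 < a1" and a2_gt_2: "2 < a2"
proof -
  have "0 \<le> (1 - \<alpha>) / B i" for i
    using \<alpha>_le_1 B_pos[of i] by simp
  moreover have "0 < 2 * \<alpha> / (B SP1 + L SP1)" "0 < 2 * \<alpha> / (B SP2 + L SP2 + C)"
    using \<alpha>_pos BL_pos C_pos by (simp_all add: add_pos_pos)
  ultimately show "2 < a1" "2 < a2"
    unfolding a1_def a2_def by (smt (verit))+
qed

text \<open>The reduced system gives \<open>x\<^sub>1\<close> and \<open>T\<^sub>2\<close> in the
  ratio of \<open>a2 - 1\<close> to \<open>a1 - 1\<close>, so the right side says that
  \<open>T\<^sub>2 / (B SP2 + L SP2 + C)\<close> is at least twice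
  \<open>x\<^sub>1 / (B SP1 + L SP1)\<close>.\<close>

lemma bandwidth_condition_iff:
  "bandwidth_condition \<alpha> B L C \<longleftrightarrow>
     2 * (B SP2 + L SP2 + C) * (a2 - 1) \<le> (B SP1 + L SP1) * (a1 - 1)"
proof -
  have expand: "M * (2 * (1 + k) + 2 * \<alpha> / M - 1) = M + 2 * (M * k) + 2 * \<alpha>"
    if "0 < M" for M k :: real
    using that by (simp add: field_simps)
  have share: "(B i + l) * ((1 - \<alpha>) / B i) = (1 - \<alpha>) + (1 - \<alpha>) * (l / B i)" for i l
    using B_pos[of i] by (simp add: field_simps)
  \<comment> \<open>The constants \<open>2 * (1 - \<alpha>)\<close> from \<open>share\<close> and
    \<open>2 * \<alpha>\<close> from \<open>expand\<close> add up to 2. For provider 2 they double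
    to 4, and the difference is the 2 in the condition.\<close>
  have 1: "(B SP1 + L SP1) * (a1 - 1)
      = B SP1 + L SP1 + 2 * (1 - \<alpha>) * (L SP1 / B SP1) + 2"
    unfolding a1_def expand[OF BL_pos] share by simp
  have "2 * (B SP2 + L SP2 + C) * (a2 - 1) = 2 * ((B SP2 + (C + L SP2)) * (a2 - 1))"
    by simp
  also have "\<dots> = 2 * (C + L SP2) + 2 * B SP2 + 4 + 4 * (1 - \<alpha>) * ((C + L SP2) / B SP2)"
  proof -
    have "0 < B SP2 + (C + L SP2)"
      using BL_pos[of SP2] C_pos by simp
    moreover have "a2 = 2 * (1 + (1 - \<alpha>) / B SP2) + 2 * \<alpha> / (B SP2 + (C + L SP2))"
      by (simp add: a2_def ac_simps)
    ultimately show ?thesis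
      by (simp only: expand share) simp
  qed
  finally show ?thesis
    unfolding bandwidth_condition_def 1 by linarith
qed

lemma asymmetric_equilibrium_necessary:
  assumes eq: "equilibrium \<alpha> B L C (x, w)"
    and pos: "w SP1 = 0" "0 < x SP1" "0 < x SP2" "0 < w SP2"
  shows "bandwidth_condition \<alpha> B L C"
    and "x SP2 / (B SP2 + L SP2) = w SP2 / C"
proof -
  define s t T where "s = x SP1 / (B SP1 + L SP1)" and "t = w SP2 / C" and "T = x SP2 + w SP2"
  have own1: "own x w SP1 = 0" and own2: "own x w SP2 = 0" and open2: "opn x w SP2 = 0"
    and open1: "opn x w SP1 \<le> 0"
    using equilibrium_own_stationary equilibrium_open_stationary equilibrium_open_nonpos eq pos
    by blast+
  have "\<alpha> * (x SP2 / (B SP2 + L SP2)) = \<alpha> * (w SP2 / C)"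
    using own2 open2 pos(1)
    by (simp add: own_marginal_def open_marginal_def sum_sp divide_inverse algebra_simps)
  then show spread: "x SP2 / (B SP2 + L SP2) = w SP2 / C"
    using \<alpha>_pos by (metis mult_left_cancel less_irrefl)
  \<comment> \<open>Subtracting \<open>own1\<close> from \<open>open1\<close> leaves congestion
    only: provider 1 compares the rival's load \<open>t\<close> with twice its own load
    \<open>s\<close>.\<close>
  have "\<alpha> * (2 * s) \<le> \<alpha> * t"
    using own1 open1 pos(1)
    by (simp add: own_marginal_def open_marginal_def sum_sp s_def t_def mult_ac)
  then have st: "2 * s \<le> t"
    using \<alpha>_pos by simp
  have x1: "x SP1 = (B SP1 + L SP1) * s" and x2: "x SP2 = (B SP2 + L SP2) * t"
    and w2: "w SP2 = C * t"
    using BL_pos[of SP1] BL_pos[of SP2] C_pos spread by (simp_all add: s_def t_def field_simps)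
  have T: "T = (B SP2 + L SP2 + C) * t"
    by (simp add: T_def x2 w2 algebra_simps)
  have t: "t = T / (B SP2 + L SP2 + C)"
    using T BL_pos[of SP2] C_pos by simp
  have 1: "a1 * x SP1 + T = 1"
    using own1 pos(1)
    by (simp add: own_marginal_def delivered_price_def sum_sp a1_def T_def divide_inverse
        algebra_simps)
  have "2 * (1 + (1 - \<alpha>) / B SP2) * T + 2 * \<alpha> * t + x SP1 = 1"
    using open2 pos(1)
    by (simp add: open_marginal_def delivered_price_def sum_sp T_def t_def divide_inverse
        algebra_simps)
  then have 2: "a2 * T + x SP1 = 1"
    by (simp add: a2_def t algebra_simps)
  have balance: "(a1 - 1) * x SP1 = (a2 - 1) * T"
    using 1 2 by (simp add: algebra_simps)
  \<comment> \<open>The condition is derived multiplied by \<open>s\<close>: \<open>2 * s\<close> is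
    raised to \<open>t\<close>, \<open>balance\<close> exchanges the providers, and
    \<open>0 < s\<close> cancels.\<close>
  have "s * (2 * (B SP2 + L SP2 + C) * (a2 - 1)) = (B SP2 + L SP2 + C) * (a2 - 1) * (2 * s)"
    by (simp only: mult_ac)
  also have "\<dots> \<le> (B SP2 + L SP2 + C) * (a2 - 1) * t"
    using st a2_gt_2 BL_pos[of SP2] C_pos by (intro mult_left_mono) auto
  also have "\<dots> = s * ((B SP1 + L SP1) * (a1 - 1))"
    using balance by (simp add: T x1 algebra_simps)
  finally show "bandwidth_condition \<alpha> B L C"
    unfolding bandwidth_condition_iff
  proof (rule mult_left_le_imp_le)
    show "0 < s"
      using pos(2) BL_pos[of SP1] by (simp add: s_def)
  qed
qed

lemma asymmetric_equilibrium_exists: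
  assumes cond: "bandwidth_condition \<alpha> B L C"
  obtains x w where "equilibrium \<alpha> B L C (x, w)"
    "w SP1 = 0" "0 < x SP1" "0 < x SP2" "0 < w SP2"
proof -
  define D where "D = a1 * a2 - 1"
  have "1 * 1 < a1 * a2"
    using a1_gt_2 a2_gt_2 by (intro mult_strict_mono) auto
  then have D: "0 < D"
    by (simp add: D_def)
  define M where "M = B SP2 + L SP2 + C"
  have M: "0 < M"
    using BL_pos[of SP2] C_pos by (simp add: M_def)
  \<comment> \<open>Cramer's rule for the reduced system, with determinant \<open>D\<close>;
    \<open>t\<close> is the load common to the own and open bands of provider 2.\<close>
  define X T t where "X = (a2 - 1) / D" and "T = (a1 - 1) / D" and "t = T / M"
  have pos: "0 < X" "0 < t" and T: "T = M * t"
    using a1_gt_2 a2_gt_2 D M by (simp_all add: X_def t_def T_def)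
  define x w where "x = (\<lambda>i. case i of SP1 \<Rightarrow> X | SP2 \<Rightarrow> (B SP2 + L SP2) * t)"
    and "w = (\<lambda>i. case i of SP1 \<Rightarrow> 0 | SP2 \<Rightarrow> C * t)"
  have x: "x SP1 = X" "x SP2 = (B SP2 + L SP2) * t" and w: "w SP1 = 0" "w SP2 = C * t"
    by (simp_all add: x_def w_def)
  have sum2: "x SP2 + w SP2 = T"
    by (simp add: x w T M_def algebra_simps)
  have frac: "x SP2 / (B SP2 + L SP2) = t" "w SP2 / C = t"
    using BL_pos[of SP2] C_pos by (simp_all add: x w)
  have sys: "a1 * X + T = 1" "a2 * T + X = 1"
    using D by (simp_all add: X_def T_def field_simps) (simp_all add: D_def algebra_simps)
  have price: "delivered_price x w = 1 - X - T"
    using sum2 by (simp add: delivered_price_def sum_sp x(1) w(1))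
  have own1: "own x w SP1 = 0"
    using sys(1)
    by (simp add: own_marginal_def price x(1) w(1) a1_def divide_inverse algebra_simps)
  have resp2: "2 * (1 + (1 - \<alpha>) / B SP2) * T + 2 * \<alpha> * t + X = 1"
    using sys(2) by (simp add: a2_def t_def M_def algebra_simps)
  have "own x w SP2 = 1 - X - T - T - 2 * (1 - \<alpha>) * (T / B SP2) - 2 * \<alpha> * t"
    by (simp only: own_marginal_def price sum2 frac)
  also have "\<dots> = 0"
    using resp2 by (simp add: divide_inverse algebra_simps)
  finally have own2: "own x w SP2 = 0" .
  have "opn x w SP2 = 1 - X - T - T - 2 * (1 - \<alpha>) * (T / B SP2) - 2 * \<alpha> * t"
    by (simp add: open_marginal_def sum_sp price sum2 w(1) mult_ac flip: frac(2))
  with own2 have open2: "opn x w SP2 = 0"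
    by (simp only: own_marginal_def price sum2 frac)
  have "2 * (X / (B SP1 + L SP1)) \<le> t"
  proof -
    have "2 * M * (a2 - 1) \<le> (B SP1 + L SP1) * (a1 - 1)"
      using cond by (simp add: bandwidth_condition_iff M_def)
    then have "2 * M * (a2 - 1) / D \<le> (B SP1 + L SP1) * (a1 - 1) / D"
      using D by (intro divide_right_mono) auto
    then have "2 * M * X \<le> (B SP1 + L SP1) * T"
      by (simp add: X_def T_def)
    then show ?thesis
      using M BL_pos[of SP1] by (simp add: t_def field_simps)
  qed
  then have "\<alpha> * (2 * (X / (B SP1 + L SP1))) \<le> \<alpha> * t"
    using \<alpha>_pos by (intro mult_left_mono) auto
  then have open1: "opn x w SP1 \<le> 0"
    using own1 frac(2)
    by (simp add: own_marginal_def open_marginal_def sum_sp x(1) w(1) mult_ac)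
  have nonneg: "0 \<le> x i \<and> 0 \<le> w i" for i
    using pos BL_pos[of SP2] C_pos by (cases i) (simp_all add: x w)
  \<comment> \<open>Three marginals vanish, so only \<open>opn x w SP1 * b \<le> 0\<close> for
    nonnegative \<open>b\<close> remains.\<close>
  have "equilibrium \<alpha> B L C (x, w)"
    unfolding equilibrium_iff_variational all_sp
    using nonneg open1 by (simp add: own1 own2 open2 w(1) mult_nonpos_nonneg)
  then show thesis
    using that pos BL_pos[of SP2] C_pos by (simp add: x w)
qed

section \<open>From equilibria to the final equivalences\<close>

lemma asymmetric_equilibrium_open_less_iff:
  assumes "equilibrium \<alpha> B L C (x, w)"
    and "w SP1 = 0" "0 < x SP1" "0 < x SP2" "0 < w SP2"
  shows "w SP2 < x SP2 \<longleftrightarrow> C < B SP2 + L SP2"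
proof -
  \<comment> \<open>Both traffics of provider 2 are bandwidth times one common load, so comparing
    them compares bandwidths.\<close>
  have eq: "x SP2 = (B SP2 + L SP2) * (w SP2 / C)"
    using asymmetric_equilibrium_necessary(2)[OF assms] BL_pos[of SP2] by (simp add: field_simps)
  have "w SP2 = C * (w SP2 / C)" "0 < w SP2 / C"
    using C_pos assms(5) by simp_all
  then show ?thesis
    by (metis eq mult_less_cancel_right_pos)
qed

lemma ex1_equilibrium_iff:
  "(\<exists>!e. equilibrium \<alpha> B L C e \<and> P e) \<longleftrightarrow> (\<exists>e. equilibrium \<alpha> B L C e \<and> P e)"
  using equilibrium_unique by blast

lemma ex_asymmetric_equilibrium_iff:
  "(\<exists>x w. equilibrium \<alpha> B L C (x, w) \<and> w SP1 = 0 \<and> x SP1 > 0 \<and> x SP2 > 0 \<and> w SP2 > 0)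
     \<longleftrightarrow> bandwidth_condition \<alpha> B L C"
  by (meson asymmetric_equilibrium_exists asymmetric_equilibrium_necessary(1))

lemma ex_asymmetric_equilibrium_open_less_iff:
  "(\<exists>x w. equilibrium \<alpha> B L C (x, w) \<and> w SP1 = 0 \<and> x SP1 > 0 \<and> x SP2 > w SP2 \<and> w SP2 > 0)
     \<longleftrightarrow> bandwidth_condition \<alpha> B L C \<and> C < B SP2 + L SP2" (is "?lhs \<longleftrightarrow> ?rhs")
proof
  assume ?lhs
  then obtain x w where e: "equilibrium \<alpha> B L C (x, w)" "w SP1 = 0" "x SP1 > 0"
    "x SP2 > w SP2" "w SP2 > 0"
    by blast
  then have "x SP2 > 0" by simp
  with e show ?rhs
    using asymmetric_equilibrium_necessary(1) asymmetric_equilibrium_open_less_iff by blast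
next
  assume ?rhs
  then show ?lhs
    by (metis asymmetric_equilibrium_exists asymmetric_equilibrium_open_less_iff)
qed

end

text \<open>The order \<open>x SP2 > w SP2\<close> needs its own equivalence: a large
  \<open>B SP1\<close> meets the bandwidth condition whatever the relation of
  \<open>\<beta> * W\<close> to \<open>B SP2 + L SP2\<close>.\<close>

theorem theorem3p4:
  fixes \<alpha> \<beta> W :: real and B L :: "sp \<Rightarrow> real"
  assumes "0 < \<alpha>" and "\<alpha> \<le> 1"
    and "0 < \<beta>" and "\<beta> \<le> 1"
    and "0 < W"
    and "\<And>i. 0 < B i" and "\<And>i. 0 \<le> L i"
    and "L SP1 + L SP2 = (1 - \<beta>) * W"
  shows "((\<exists>!e. equilibrium \<alpha> B L (\<beta> * W) e \<and>
            (case e of (x, w) \<Rightarrow> w SP1 = 0 \<and> x SP1 > 0 \<and> x SP2 > 0 \<and> w SP2 > 0))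
           \<longleftrightarrow> bandwidth_condition \<alpha> B L (\<beta> * W))
    \<and> ((\<exists>!e. equilibrium \<alpha> B L (\<beta> * W) e \<and>
            (case e of (x, w) \<Rightarrow> w SP1 = 0 \<and> x SP1 > 0 \<and> x SP2 > w SP2 \<and> w SP2 > 0))
           \<longleftrightarrow> bandwidth_condition \<alpha> B L (\<beta> * W) \<and> \<beta> * W < B SP2 + L SP2)
    \<and> (bandwidth_condition \<alpha> B L (\<beta> * W) \<longrightarrow> (\<exists>!e. equilibrium \<alpha> B L (\<beta> * W) e))
    \<and> (\<beta> = 1 \<longrightarrow> L SP1 = 0 \<and> L SP2 = 0 \<and>
           (bandwidth_condition \<alpha> B L (\<beta> * W)
              \<longleftrightarrow> B SP1 \<ge> 2 * W + 4 * (1 - \<alpha>) * (W / B SP2) + 2 * B SP2 + 2))"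
proof -
  interpret bandwidth_game \<alpha> B L "\<beta> * W"
    using assms by unfold_locales auto
  have ex: "\<exists>!e. equilibrium \<alpha> B L (\<beta> * W) e" if "bandwidth_condition \<alpha> B L (\<beta> * W)"
    using asymmetric_equilibrium_exists[OF that] equilibrium_unique by metis
  have full: "L SP1 = 0 \<and> L SP2 = 0" if "\<beta> = 1"
    using assms(8) L_nonneg[of SP1] L_nonneg[of SP2] that by simp
  then have "bandwidth_condition \<alpha> B L (\<beta> * W)
      \<longleftrightarrow> B SP1 \<ge> 2 * W + 4 * (1 - \<alpha>) * (W / B SP2) + 2 * B SP2 + 2" if "\<beta> = 1"
    using that by (auto simp: bandwidth_condition_def)
  with ex full show ?thesis
    unfolding ex1_equilibrium_iff split_paired_Ex prod.case
      ex_asymmetric_equilibrium_iff ex_asymmetric_equilibrium_open_less_iff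
    by blast
qed

end
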